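(* Let $\{X_t\}_{t\in\mathbb{R}}$ be a family of Banach spaces and let $S(t,s):X_s\to X_t$, $s\le t$, be a process possessing a pullback absorber $\mathbb{A}=\{\mathbb{A}(t)\}_{t\in\mathbb{R}}$ for which $$\lim_{s\to-\infty}\alpha_t\big(S(t,s)\mathbb{A}(s)\big)=0\qquad\forall t\in\mathbb{R}.$$ Then the global attractor $\mathcal{A}(t)=\omega_{\mathbb{A}}(t)$ satisfies $$\mathcal{A}(t)=\omega_{\mathbb{A}}(t)\subset\mathbb{A}(t)\qquad\forall t\in\mathbb{R}.$$ In particular, $\mathcal{A}=\{\mathcal{A}(t)\}_{t\in\mathbb{R}}$ is a pullback-bounded family, and therefore it is the unique time-dependent global attractor for $S(\cdot,\cdot)$ in the class of pullback-bounded families.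
   Context: A process is a family of maps $S(t,s):X_s\to X_t$, $s\le t$, such that $S(t,t)=\mathrm{Id}_{X_t}$, $S(t,s)$ is continuous, and $S(\tau,t)S(t,s)=S(\tau,s)$ for $s\le t\le\tau$. A family $\mathcal{B}=\{\mathcal{B}(t)\subset X_t\}_{t\in\mathbb{R}}$ is pullback-bounded if $\sup_{s\in(-\infty,t]}\sup_{z\in\mathcal{B}(s)}\|z\|_{X_s}<\infty$ for every $t\in\mathbb{R}$. A pullback-bounded family $\mathbb{A}$ is a pullback absorber if for every pullback-bounded family $\mathcal{B}$ and every $t\in\mathbb{R}$ there is $t_0=t_0(t)\le t$ with $S(t,s)\mathcal{B}(s)\subset\mathbb{A}(t)$ for all $s\le t_0$. The time-dependent $\omega$-limit of a family $\mathcal{B}$ is $\omega_{\mathcal{B}}(t)=\bigcap_{\tau\le t}\overline{\bigcup_{s\le\tau}S(t,s)\mathcal{B}(s)}$, closures in $X_t$; equivalently, $\omega_{\mathcal{B}}(t)$ is the set of $z\in X_t$ for which there are $s_n\to-\infty$, $z_n\in\mathcal{B}(s_n)$ with $\|S(t,s_n)z_n-z\|_{X_t}\to0$. A time-dependent global attractor is a family of compact sets $\mathcal{A}(t)\subset X_t$ such that (i) $S(t,s)\mathcal{A}(s)=\mathcal{A}(t)$ for all $s\le t$; (ii) for every pullback-bounded $\mathcal{B}$ and every $t\in\mathbb{R}$, $\lim_{s\to-\infty}\mathrm{dist}_{X_t}(S(t,s)\mathcal{B}(s),\mathcal{A}(t))=0$, where $\mathrm{dist}_X(B,C)=\sup_{x\in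 B}\inf_{y\in C}\|x-y\|_X$. $\alpha_t$ is the Kuratowski measure of noncompactness in $X_t$: $\alpha_t(B)=\inf\{\delta>0: B$ is covered by finitely many $X_t$-balls of radius $\delta\}$. Known fact: under the stated hypothesis on $\mathbb{A}$, $\omega_{\mathbb{A}}$ is a time-dependent global attractor for $S(\cdot,\cdot)$. *)

theory Defs
  imports "HOL-Analysis.Analysis"
begin

text \<open>
  HOL has no types depending on \<open>t\<close>, so a family of Banach spaces is given by linear subspaces
  \<open>X t\<close> of a common real vector space, each with its own norm \<open>N t\<close>; the norms at different times
  are unrelated.  Since the ambient vector space is arbitrary, this loses no generality: any
  family of Banach spaces embeds, space by space, into its algebraic direct sum.  Nothing is
  assumed about \<open>N t\<close> outside \<open>X t\<close>, nor about \<open>S t s\<close> when \<open>s > t\<close>.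
\<close>

definition norm_on :: "'a::real_vector set \<Rightarrow> ('a \<Rightarrow> real) \<Rightarrow> bool" where
  "norm_on V N \<longleftrightarrow> subspace V
     \<and> (\<forall>x\<in>V. 0 \<le> N x)
     \<and> (\<forall>x\<in>V. N x = 0 \<longleftrightarrow> x = 0)
     \<and> (\<forall>c. \<forall>x\<in>V. N (c *\<^sub>R x) = \<bar>c\<bar> * N x)
     \<and> (\<forall>x\<in>V. \<forall>y\<in>V. N (x + y) \<le> N x + N y)"

text \<open>The locale \<open>Metric_space\<close> requires symmetry and nonnegativity also off the carrier, whence
  the value 0 there.\<close>

definition norm_dist :: "'a::real_vector set \<Rightarrow> ('a \<Rightarrow> real) \<Rightarrow> 'a \<Rightarrow> 'a \<Rightarrow> real" where
  "norm_dist V N x y = (if x \<in> V \<and> y \<in> V then N (x - y) else 0)"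

lemma Metric_space_norm_dist:
  assumes "norm_on V N"
  shows "Metric_space V (norm_dist V N)"
proof
  have V: "subspace V" and nn: "\<And>x. x \<in> V \<Longrightarrow> 0 \<le> N x" and z: "\<And>x. x \<in> V \<Longrightarrow> N x = 0 \<longleftrightarrow> x = 0"
    and sc: "\<And>c x. x \<in> V \<Longrightarrow> N (c *\<^sub>R x) = \<bar>c\<bar> * N x"
    and tri: "\<And>x y. x \<in> V \<Longrightarrow> y \<in> V \<Longrightarrow> N (x + y) \<le> N x + N y"
    using assms by (simp_all add: norm_on_def)
  have nn': "0 \<le> N (x - y)" if "x \<in> V" "y \<in> V" for x y
    by (rule nn[OF subspace_diff[OF V that]])
  have z': "N (x - y) = 0 \<longleftrightarrow> x = y" if "x \<in> V" "y \<in> V" for x y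
    using z[OF subspace_diff[OF V that]] by simp
  have sym: "N (x - y) = N (y - x)" if "x \<in> V" "y \<in> V" for x y
    using sc[OF subspace_diff[OF V that(2,1)], of "-1"] by simp
  have tri': "N (x - w) \<le> N (x - y) + N (y - w)" if "x \<in> V" "y \<in> V" "w \<in> V" for x y w
    using tri[OF subspace_diff[OF V that(1,2)] subspace_diff[OF V that(2,3)]] by simp
  show "0 \<le> norm_dist V N x y" for x y
    by (simp add: norm_dist_def nn')
  show "norm_dist V N x y = norm_dist V N y x" for x y
    unfolding norm_dist_def using sym[of x y] by presburger
  show "norm_dist V N x y = 0 \<longleftrightarrow> x = y" if "x \<in> V" "y \<in> V" for x y
    by (simp add: norm_dist_def that z')
  show "norm_dist V N x w \<le> norm_dist V N x y + norm_dist V N y w"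
    if "x \<in> V" "y \<in> V" "w \<in> V" for x y w
    by (simp add: norm_dist_def that tri')
qed

definition norm_topology :: "'a::real_vector set \<Rightarrow> ('a \<Rightarrow> real) \<Rightarrow> 'a topology" where
  "norm_topology V N = Metric_space.mtopology V (norm_dist V N)"

definition banach_on :: "'a::real_vector set \<Rightarrow> ('a \<Rightarrow> real) \<Rightarrow> bool" where
  "banach_on V N \<longleftrightarrow> norm_on V N \<and> Metric_space.mcomplete V (norm_dist V N)"

definition process ::
  "(real \<Rightarrow> 'a::real_vector set) \<Rightarrow> (real \<Rightarrow> 'a \<Rightarrow> real) \<Rightarrow> (real \<Rightarrow> real \<Rightarrow> 'a \<Rightarrow> 'a) \<Rightarrow> bool" where
  "process X N S \<longleftrightarrow>
     (\<forall>t. \<forall>x\<in>X t. S t t x = x)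
     \<and> (\<forall>s t. s \<le> t \<longrightarrow> continuous_map (norm_topology (X s) (N s)) (norm_topology (X t) (N t)) (S t s))
     \<and> (\<forall>s t \<tau>. s \<le> t \<and> t \<le> \<tau> \<longrightarrow> (\<forall>x\<in>X s. S \<tau> t (S t s x) = S \<tau> s x))"

text \<open>Suprema and infima of norms are taken in \<open>ennreal\<close>: they may be infinite, and the supremum
  over the empty set is 0.\<close>

definition pullback_bounded ::
  "(real \<Rightarrow> 'a::real_vector set) \<Rightarrow> (real \<Rightarrow> 'a \<Rightarrow> real) \<Rightarrow> (real \<Rightarrow> 'a set) \<Rightarrow> bool" where
  "pullback_bounded X N B \<longleftrightarrow>
     (\<forall>t. B t \<subseteq> X t) \<and> (\<forall>t. (SUP s\<in>{..t}. SUP z\<in>B s. ennreal (N s z)) < \<infinity>)"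

definition pullback_absorber ::
  "(real \<Rightarrow> 'a::real_vector set) \<Rightarrow> (real \<Rightarrow> 'a \<Rightarrow> real) \<Rightarrow> (real \<Rightarrow> real \<Rightarrow> 'a \<Rightarrow> 'a) \<Rightarrow>
    (real \<Rightarrow> 'a set) \<Rightarrow> bool" where
  "pullback_absorber X N S A \<longleftrightarrow> pullback_bounded X N A
     \<and> (\<forall>B. pullback_bounded X N B \<longrightarrow> (\<forall>t. \<exists>t0\<le>t. \<forall>s\<le>t0. S t s ` B s \<subseteq> A t))"

definition omega_limit ::
  "(real \<Rightarrow> 'a::real_vector set) \<Rightarrow> (real \<Rightarrow> 'a \<Rightarrow> real) \<Rightarrow> (real \<Rightarrow> real \<Rightarrow> 'a \<Rightarrow> 'a) \<Rightarrow>
    (real \<Rightarrow> 'a set) \<Rightarrow> real \<Rightarrow> 'a set" where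
  "omega_limit X N S B t =
     (\<Inter>\<tau>\<in>{..t}. norm_topology (X t) (N t) closure_of (\<Union>s\<in>{..\<tau>}. S t s ` B s))"

definition semidist :: "('a::real_vector \<Rightarrow> real) \<Rightarrow> 'a set \<Rightarrow> 'a set \<Rightarrow> ennreal" where
  "semidist N B C = (SUP x\<in>B. INF y\<in>C. ennreal (N (x - y)))"

definition time_dependent_global_attractor ::
  "(real \<Rightarrow> 'a::real_vector set) \<Rightarrow> (real \<Rightarrow> 'a \<Rightarrow> real) \<Rightarrow> (real \<Rightarrow> real \<Rightarrow> 'a \<Rightarrow> 'a) \<Rightarrow>
    (real \<Rightarrow> 'a set) \<Rightarrow> bool" where
  "time_dependent_global_attractor X N S A \<longleftrightarrow>
     (\<forall>t. compactin (norm_topology (X t) (N t)) (A t))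
     \<and> (\<forall>s t. s \<le> t \<longrightarrow> S t s ` A s = A t)
     \<and> (\<forall>B. pullback_bounded X N B \<longrightarrow>
          (\<forall>t. ((\<lambda>s. semidist (N t) (S t s ` B s) (A t)) \<longlongrightarrow> 0) at_bot))"

text \<open>The infimum is \<open>\<infinity>\<close> if no finite cover by balls of equal radius exists.\<close>

definition kuratowski :: "'a::real_vector set \<Rightarrow> ('a \<Rightarrow> real) \<Rightarrow> 'a set \<Rightarrow> ennreal" where
  "kuratowski V N B =
     (INF \<delta>\<in>{\<delta>::real. 0 < \<delta> \<and> (\<exists>C. finite C \<and> C \<subseteq> V \<and>
        B \<subseteq> (\<Union>c\<in>C. Metric_space.mball V (norm_dist V N) c \<delta>))}. ennreal \<delta>)"

end

theory Submission
  imports Defs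
begin

text \<open>
  Everything rests on one compactness statement, \<open>asymptotically_compact\<close>: if \<open>B\<close> is
  pullback-bounded, \<open>\<sigma> n \<longlonglongrightarrow> -\<infinity>\<close> and \<open>b n \<in> B (\<sigma> n)\<close>, then the states \<open>S t (\<sigma> n) (b n)\<close> have a
  subsequence that converges to a point of \<open>\<omega>(t)\<close>, the \<open>\<omega>\<close>-limit of the absorber \<open>AA\<close>.  Indeed, by
  absorption at an intermediate time \<open>\<tau>\<close>, almost all of these states lie in \<open>S t \<tau> ` AA \<tau>\<close>.  A
  suitable choice of \<open>\<tau>\<close> makes the Kuratowski measure of this set small, so the sequence is totally
  bounded, and \<open>X t\<close> is complete.  The limit lies in the closure of \<open>S t \<tau> ` AA \<tau>\<close> for every
  \<open>\<tau> \<le> t\<close>, hence in \<open>\<omega>(t)\<close>.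

  Compactness, attraction and the invariance \<open>S t s ` \<omega>(s) = \<omega>(t)\<close> follow by passing to subsequences.

  The inclusion \<open>\<omega>(t) \<subseteq> AA t\<close> takes a detour, since \<open>AA t\<close> need not be closed.  As \<open>AA\<close> absorbs itself,
  \<open>\<omega>(t)\<close> lies in the closure of \<open>AA t\<close>, which has the same bound as \<open>AA t\<close>; so \<open>\<omega>\<close> is
  pullback-bounded.  Therefore \<open>AA\<close> absorbs \<open>\<omega>\<close>, and \<open>\<omega>(t) = S t s ` \<omega>(s) \<subseteq> AA t\<close> for \<open>s\<close> near
  \<open>-\<infinity>\<close>.

  Uniqueness: an invariant pullback-bounded family is attracted by every attractor, and since
  invariance makes the distance in question independent of \<open>s\<close>, it is contained in every attractor.
\<close>

section \<open>Sequences in metric spaces and pullback-bounded families\<close>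

text \<open>
  The range of \<open>\<sigma>\<close> is totally bounded: the finitely many terms that a net misses can be added to it,
  and a centre whose ball meets the sequence can be replaced by a term of the sequence at the cost of
  doubling the radius.
\<close>

lemma (in Metric_space) convergent_subsequence_of_eventual_nets:
  assumes "mcomplete" and ran: "range \<sigma> \<subseteq> M"
    and net: "\<And>\<epsilon>. 0 < \<epsilon> \<Longrightarrow>
      \<exists>K. finite K \<and> K \<subseteq> M \<and> (\<forall>\<^sub>F n in sequentially. \<sigma> n \<in> (\<Union>x\<in>K. mball x \<epsilon>))"
  obtains l r where "strict_mono r" "limitin mtopology (\<sigma> \<circ> r) l sequentially"
proof -
  have "mtotally_bounded (range \<sigma>)"
    unfolding mtotally_bounded_def
  proof (intro allI impI)
    fix \<epsilon> :: real assume "0 < \<epsilon>"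
    then obtain K n0 where K: "finite K" "K \<subseteq> M"
        and n0: "\<And>n. n0 \<le> n \<Longrightarrow> \<sigma> n \<in> (\<Union>x\<in>K. mball x (\<epsilon>/2))"
      using net[of "\<epsilon>/2"] by (auto simp: eventually_sequentially simp del: in_mball)
    define L where "L = {x \<in> K. \<exists>n. \<sigma> n \<in> mball x (\<epsilon>/2)}"
    have "\<forall>x\<in>L. \<exists>n. \<sigma> n \<in> mball x (\<epsilon>/2)" by (simp add: L_def)
    from bchoice[OF this] obtain f where f: "\<And>x. x \<in> L \<Longrightarrow> \<sigma> (f x) \<in> mball x (\<epsilon>/2)"
      by blast
    let ?K = "\<sigma> ` f ` L \<union> \<sigma> ` {..<n0}"
    have "\<sigma> n \<in> (\<Union>y\<in>?K. mball y \<epsilon>)" for n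
    proof (cases "n < n0")
      case True
      then show ?thesis using ran \<open>0 < \<epsilon>\<close> by (force intro!: UN_I[of "\<sigma> n"])
    next
      case False
      then obtain x where x: "x \<in> K" "\<sigma> n \<in> mball x (\<epsilon>/2)" using n0[of n] by auto
      then have "x \<in> L" by (auto simp: L_def)
      then have "\<sigma> (f x) \<in> mball x (\<epsilon>/2)" by (rule f)
      with x have "d (\<sigma> (f x)) (\<sigma> n) < \<epsilon>"
        using triangle'[of "\<sigma> (f x)" x "\<sigma> n"] by (auto simp: commute)
      with \<open>x \<in> L\<close> ran show ?thesis by (intro UN_I[of "\<sigma> (f x)"]) auto
    qed
    moreover have "finite ?K" using K by (simp add: L_def)
    ultimately show "\<exists>K. finite K \<and> K \<subseteq> range \<sigma> \<and> range \<sigma> \<subseteq> (\<Union>x\<in>K. mball x \<epsilon>)"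
      by (intro exI[of _ ?K]) blast
  qed
  then obtain r where r: "strict_mono (r :: nat \<Rightarrow> nat)" "MCauchy (\<sigma> \<circ> r)"
    unfolding mtotally_bounded_sequentially by blast
  with \<open>mcomplete\<close> show ?thesis using that unfolding mcomplete_def by blast
qed

lemma filterlim_at_bot_if_le_minus_nat:
  fixes \<sigma> :: "nat \<Rightarrow> real"
  assumes "\<And>n. \<sigma> n \<le> - real n"
  shows "filterlim \<sigma> at_bot sequentially"
proof (rule filterlim_at_bot_mono)
  show "filterlim (\<lambda>n. - real n) at_bot sequentially"
    by (simp add: filterlim_uminus_at_bot filterlim_real_sequentially)
qed (use assms in simp)

lemma pullback_bounded_iff:
  "pullback_bounded X N B \<longleftrightarrow>
    (\<forall>t. B t \<subseteq> X t) \<and> (\<forall>t. \<exists>C. \<forall>s\<le>t. \<forall>z\<in>B s. N s z \<le> C)"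
proof -
  have "(SUP s\<in>{..t}. SUP z\<in>B s. ennreal (N s z)) < \<infinity> \<longleftrightarrow> (\<exists>C. \<forall>s\<le>t. \<forall>z\<in>B s. N s z \<le> C)"
    (is "?M < \<infinity> \<longleftrightarrow> ?R") for t
  proof
    assume "?M < \<infinity>"
    then obtain C where C: "0 \<le> C" "?M = ennreal C" by (cases ?M) auto
    have "N s z \<le> C" if "s \<le> t" "z \<in> B s" for s z
    proof -
      have "ennreal (N s z) \<le> ?M"
        using that by (intro SUP_upper2[of s] SUP_upper2[of z]) auto
      then show ?thesis using C by simp
    qed
    then show ?R by blast
  next
    assume ?R
    then obtain C where "\<And>s z. s \<le> t \<Longrightarrow> z \<in> B s \<Longrightarrow> N s z \<le> C" by blast
    then have "?M \<le> ennreal C" by (auto intro!: SUP_least ennreal_leI)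
    then show "?M < \<infinity>" using ennreal_less_top infinity_ennreal_def le_less_trans by metis
  qed
  then show ?thesis by (simp add: pullback_bounded_def)
qed

section \<open>Bounded attractors are minimal\<close>

text \<open>
  By invariance the distance of \<open>S t s ` A s = A t\<close> to \<open>B t\<close> does not depend on \<open>s\<close>; as it tends to
  0, it is 0, so \<open>A t\<close> lies in the closure of \<open>B t\<close>, which is \<open>B t\<close> itself by compactness.
\<close>

lemma attractor_subset_attractor:
  assumes nrm: "norm_on (X t) (N t)"
    and A: "time_dependent_global_attractor X N S A" "pullback_bounded X N A"
    and B: "time_dependent_global_attractor X N S B"
  shows "A t \<subseteq> B t"
proof
  interpret M: Metric_space "X t" "norm_dist (X t) (N t)"
    by (rule Metric_space_norm_dist[OF nrm])
  fix x assume x: "x \<in> A t"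
  with A(2) have xX: "x \<in> X t" by (auto simp: pullback_bounded_def)
  have BX: "compactin M.mtopology (B t)"
    using B by (simp add: time_dependent_global_attractor_def norm_topology_def)
  have "((\<lambda>s. semidist (N t) (S t s ` A s) (B t)) \<longlongrightarrow> 0) at_bot"
    using A(2) B by (simp add: time_dependent_global_attractor_def)
  moreover have "\<forall>\<^sub>F s in at_bot. semidist (N t) (S t s ` A s) (B t) = semidist (N t) (A t) (B t)"
    using A(1) by (auto simp: time_dependent_global_attractor_def
      intro!: eventually_mono[OF eventually_le_at_bot[of t]])
  ultimately have "((\<lambda>s::real. semidist (N t) (A t) (B t)) \<longlongrightarrow> 0) at_bot"
    by (rule Lim_transform_eventually)
  then have "semidist (N t) (A t) (B t) = 0"
    by (simp add: tendsto_const_iff)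
  then have 0: "(INF y\<in>B t. ennreal (N t (x - y))) = 0"
    unfolding semidist_def
    using SUP_upper[OF x, of "\<lambda>x. INF y\<in>B t. ennreal (N t (x - y))"] by simp
  have "\<exists>y\<in>B t. y \<in> M.mball x r" if "0 < r" for r
  proof -
    have "(INF y\<in>B t. ennreal (N t (x - y))) < ennreal r" using 0 that by simp
    then obtain y where y: "y \<in> B t" "ennreal (N t (x - y)) < ennreal r"
      unfolding INF_less_iff by blast
    then have "N t (x - y) < r" by (meson ennreal_leI not_le)
    moreover have "y \<in> X t" using y compactin_subset_topspace[OF BX] by auto
    ultimately show ?thesis using xX y by (auto simp: norm_dist_def)
  qed
  then have "x \<in> M.mtopology closure_of B t" using xX by (simp add: M.metric_closure_of)
  moreover have "closedin M.mtopology (B t)"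
    by (rule compactin_imp_closedin[OF M.Hausdorff_space_mtopology BX])
  ultimately show "x \<in> B t" by (simp add: closure_of_closedin)
qed

section \<open>Asymptotic compactness\<close>

locale kuratowski_absorbed_process =
  fixes X :: "real \<Rightarrow> 'a::real_vector set"
    and N :: "real \<Rightarrow> 'a \<Rightarrow> real"
    and S :: "real \<Rightarrow> real \<Rightarrow> 'a \<Rightarrow> 'a"
    and AA :: "real \<Rightarrow> 'a set"
  assumes banach: "\<And>t. banach_on (X t) (N t)"
    and process: "process X N S"
    and absorber: "pullback_absorber X N S AA"
    and kuratowski_tendsto_0: "\<And>t. ((\<lambda>s. kuratowski (X t) (N t) (S t s ` AA s)) \<longlongrightarrow> 0) at_bot"
begin

lemma norm: "norm_on (X t) (N t)"
  using banach by (simp add: banach_on_def)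

lemmas metric = Metric_space_norm_dist[OF norm]

lemma complete: "Metric_space.mcomplete (X t) (norm_dist (X t) (N t))"
  using banach by (simp add: banach_on_def)

lemma topspace_norm_topology [simp]: "topspace (norm_topology (X t) (N t)) = X t"
  by (simp add: norm_topology_def Metric_space.topspace_mtopology[OF metric])

lemma Hausdorff_norm_topology: "Hausdorff_space (norm_topology (X t) (N t))"
  by (simp add: norm_topology_def Metric_space.Hausdorff_space_mtopology[OF metric])

lemma continuous: "s \<le> t \<Longrightarrow> continuous_map (norm_topology (X s) (N s)) (norm_topology (X t) (N t)) (S t s)"
  using process by (simp add: process_def)

lemma evolve_in: "s \<le> t \<Longrightarrow> x \<in> X s \<Longrightarrow> S t s x \<in> X t"
  using continuous_map_image_subset_topspace[OF continuous] by fastforce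

lemma evolve_evolve: "s \<le> t \<Longrightarrow> t \<le> u \<Longrightarrow> x \<in> X s \<Longrightarrow> S u t (S t s x) = S u s x"
  using process by (auto simp: process_def)

lemma bounded_in: "pullback_bounded X N B \<Longrightarrow> x \<in> B t \<Longrightarrow> x \<in> X t"
  by (auto simp: pullback_bounded_def)

lemma absorber_bounded: "pullback_bounded X N AA"
  using absorber by (simp add: pullback_absorber_def)

lemma absorbs:
  assumes "pullback_bounded X N B"
  shows "\<forall>\<^sub>F s in at_bot. S t s ` B s \<subseteq> AA t"
  using absorber assms unfolding pullback_absorber_def eventually_at_bot_linorder by blast

text \<open>
  Factoring \<open>S t (\<sigma> n)\<close> through the fixed time \<open>\<tau>\<close> replaces the varying sets \<open>B (\<sigma> n)\<close> by the single
  set \<open>AA \<tau>\<close>.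
\<close>

lemma eventually_absorbed:
  assumes B: "pullback_bounded X N B" and \<sigma>: "filterlim \<sigma> at_bot sequentially"
    and b: "\<And>n. b n \<in> B (\<sigma> n)" and "\<tau> \<le> t"
  shows "\<forall>\<^sub>F n in sequentially. S t (\<sigma> n) (b n) \<in> S t \<tau> ` AA \<tau>"
proof -
  have "\<forall>\<^sub>F s in at_bot. S \<tau> s ` B s \<subseteq> AA \<tau> \<and> s \<le> \<tau>"
    by (intro eventually_conj absorbs[OF B] eventually_le_at_bot)
  then have "\<forall>\<^sub>F n in sequentially. S \<tau> (\<sigma> n) ` B (\<sigma> n) \<subseteq> AA \<tau> \<and> \<sigma> n \<le> \<tau>"
    using \<sigma> by (rule eventually_compose_filterlim)
  then show ?thesis
  proof (rule eventually_mono)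
    fix n assume n: "S \<tau> (\<sigma> n) ` B (\<sigma> n) \<subseteq> AA \<tau> \<and> \<sigma> n \<le> \<tau>"
    then have "S t (\<sigma> n) (b n) = S t \<tau> (S \<tau> (\<sigma> n) (b n))"
      using evolve_evolve[of "\<sigma> n" \<tau> t "b n"] \<open>\<tau> \<le> t\<close> bounded_in[OF B b] by simp
    then show "S t (\<sigma> n) (b n) \<in> S t \<tau> ` AA \<tau>"
      using n b[of n] by auto
  qed
qed

lemma finite_net_of_late_image:
  assumes "0 < \<epsilon>"
  obtains \<tau> K where "\<tau> \<le> t" "finite K" "K \<subseteq> X t"
    "S t \<tau> ` AA \<tau> \<subseteq> (\<Union>c\<in>K. Metric_space.mball (X t) (norm_dist (X t) (N t)) c \<epsilon>)"
proof -
  interpret M: Metric_space "X t" "norm_dist (X t) (N t)" by (rule metric)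
  have "\<forall>\<^sub>F s in at_bot. kuratowski (X t) (N t) (S t s ` AA s) < ennreal \<epsilon> \<and> s \<le> t"
    using kuratowski_tendsto_0[of t] assms
    by (intro eventually_conj order_tendstoD eventually_le_at_bot) auto
  then obtain \<tau> where \<tau>: "\<tau> \<le> t" "kuratowski (X t) (N t) (S t \<tau> ` AA \<tau>) < ennreal \<epsilon>"
    using eventually_happens'[OF trivial_limit_at_bot_linorder] by blast
  from \<tau>(2) obtain \<delta> where \<delta>: "0 < \<delta>" "ennreal \<delta> < ennreal \<epsilon>"
      "\<exists>K. finite K \<and> K \<subseteq> X t \<and> S t \<tau> ` AA \<tau> \<subseteq> (\<Union>c\<in>K. M.mball c \<delta>)"
    by (auto simp only: kuratowski_def INF_less_iff Bex_def mem_Collect_eq)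
  then obtain K where K: "finite K" "K \<subseteq> X t" "S t \<tau> ` AA \<tau> \<subseteq> (\<Union>c\<in>K. M.mball c \<delta>)"
    by (elim exE conjE)
  from \<delta> have "\<delta> \<le> \<epsilon>" by (simp add: ennreal_less_iff)
  then have "(\<Union>c\<in>K. M.mball c \<delta>) \<subseteq> (\<Union>c\<in>K. M.mball c \<epsilon>)"
    by (intro UN_mono M.mball_subset_concentric) auto
  with K(3) have "S t \<tau> ` AA \<tau> \<subseteq> (\<Union>c\<in>K. M.mball c \<epsilon>)" by (rule subset_trans)
  with \<tau>(1) K(1,2) show ?thesis by (rule that)
qed

lemma omega_limit_iff:
  "z \<in> omega_limit X N S B t \<longleftrightarrow> z \<in> X t \<and>
    (\<forall>\<tau>\<le>t. \<forall>\<epsilon>>0. \<exists>s\<le>\<tau>. \<exists>b\<in>B s. S t s b \<in> Metric_space.mball (X t) (norm_dist (X t) (N t)) z \<epsilon>)"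
proof -
  interpret M: Metric_space "X t" "norm_dist (X t) (N t)" by (rule metric)
  have "(\<exists>y\<in>(\<Union>s\<in>{..\<tau>}. S t s ` B s). y \<in> M.mball z \<epsilon>) \<longleftrightarrow>
      (\<exists>s\<le>\<tau>. \<exists>b\<in>B s. S t s b \<in> M.mball z \<epsilon>)" for \<tau> \<epsilon>
    by blast
  then have "z \<in> omega_limit X N S B t \<longleftrightarrow> (\<forall>\<tau>\<in>{..t}. z \<in> X t \<and>
      (\<forall>\<epsilon>>0. \<exists>s\<le>\<tau>. \<exists>b\<in>B s. S t s b \<in> M.mball z \<epsilon>))"
    by (simp only: omega_limit_def norm_topology_def M.metric_closure_of INT_iff mem_Collect_eq)
  then show ?thesis by blast
qed

text \<open>
  The limit belongs to the \<open>\<omega>\<close>-limit of the absorber, although the sequence starts in an arbitrary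
  pullback-bounded family \<open>B\<close>; this is what makes the \<open>\<omega>\<close>-limit of \<open>AA\<close> attract every such \<open>B\<close>.
\<close>

lemma asymptotically_compact:
  assumes B: "pullback_bounded X N B" and \<sigma>: "filterlim \<sigma> at_bot sequentially"
    and le: "\<And>n. \<sigma> n \<le> t" and b: "\<And>n. b n \<in> B (\<sigma> n)"
  obtains z r where "z \<in> omega_limit X N S AA t" "strict_mono r"
    "limitin (norm_topology (X t) (N t)) ((\<lambda>n. S t (\<sigma> n) (b n)) \<circ> r) z sequentially"
proof -
  interpret M: Metric_space "X t" "norm_dist (X t) (N t)" by (rule metric)
  let ?y = "\<lambda>n. S t (\<sigma> n) (b n)"
  have "range ?y \<subseteq> X t" using evolve_in[OF le bounded_in[OF B b]] by blast
  moreover have "\<exists>K. finite K \<and> K \<subseteq> X t \<and> (\<forall>\<^sub>F n in sequentially. ?y n \<in> (\<Union>x\<in>K. M.mball x \<epsilon>))"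
    if \<epsilon>: "0 < \<epsilon>" for \<epsilon>
  proof -
    obtain \<tau> K where "\<tau> \<le> t" "finite K" "K \<subseteq> X t" "S t \<tau> ` AA \<tau> \<subseteq> (\<Union>c\<in>K. M.mball c \<epsilon>)"
      using finite_net_of_late_image[OF \<epsilon>] by blast
    moreover from this have "\<forall>\<^sub>F n in sequentially. ?y n \<in> (\<Union>x\<in>K. M.mball x \<epsilon>)"
      using eventually_absorbed[OF B \<sigma> b \<open>\<tau> \<le> t\<close>] by (elim eventually_mono) blast
    ultimately show ?thesis by blast
  qed
  ultimately obtain z r where r: "strict_mono r" and lim: "limitin M.mtopology (?y \<circ> r) z sequentially"
    by (rule M.convergent_subsequence_of_eventual_nets[OF complete])
  have "z \<in> norm_topology (X t) (N t) closure_of (\<Union>s\<in>{..\<tau>}. S t s ` AA s)" if "\<tau> \<le> t" for \<tau>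
  proof (rule limitin_closedin)
    show "limitin (norm_topology (X t) (N t)) (?y \<circ> r) z sequentially"
      using lim by (simp add: norm_topology_def)
    have "\<forall>\<^sub>F n in sequentially. ?y n \<in> S t \<tau> ` AA \<tau>"
      by (rule eventually_absorbed[OF B \<sigma> b that])
    then have ev: "\<forall>\<^sub>F n in sequentially. ?y (r n) \<in> S t \<tau> ` AA \<tau>"
      by (rule eventually_subseq[OF r])
    have "S t \<tau> ` AA \<tau> \<subseteq> norm_topology (X t) (N t) closure_of (\<Union>s\<in>{..\<tau>}. S t s ` AA s)"
    proof -
      have "S t s b \<in> X t" if "s \<le> \<tau>" "b \<in> AA s" for s b
        using evolve_in[of s t b] bounded_in[OF absorber_bounded] that \<open>\<tau> \<le> t\<close> by simp
      then have "(\<Union>s\<in>{..\<tau>}. S t s ` AA s) \<subseteq> topspace (norm_topology (X t) (N t))"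
        by auto
      from closure_of_subset[OF this] show ?thesis by blast
    qed
    with ev show "\<forall>\<^sub>F n in sequentially. (?y \<circ> r) n \<in>
        norm_topology (X t) (N t) closure_of (\<Union>s\<in>{..\<tau>}. S t s ` AA s)"
      by (auto elim!: eventually_mono)
  qed auto
  then have "z \<in> omega_limit X N S AA t" by (simp add: omega_limit_def)
  then show ?thesis using that r lim by (simp add: norm_topology_def)
qed

section \<open>The limit set of the absorber is an attractor\<close>

lemma omega_limit_in: "z \<in> omega_limit X N S B t \<Longrightarrow> z \<in> X t"
  by (simp add: omega_limit_iff)

text \<open>
  A whole sequence of limit points is approximated along one sequence of times: constant \<open>w\<close> gives
  the sequential description of \<open>\<omega>\<close>-limits, while general \<open>w\<close> gives sequential compactness.
\<close>

lemma approximating_sequence: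
  assumes "\<And>n. w n \<in> omega_limit X N S AA t"
  obtains \<sigma> b where "filterlim \<sigma> at_bot sequentially" "\<And>n. \<sigma> n \<le> t" "\<And>n. b n \<in> AA (\<sigma> n)"
    "(\<lambda>n. norm_dist (X t) (N t) (w n) (S t (\<sigma> n) (b n))) \<longlonglongrightarrow> 0"
proof -
  interpret M: Metric_space "X t" "norm_dist (X t) (N t)" by (rule metric)
  have "\<exists>s\<le>min t (- real n). \<exists>b\<in>AA s. S t s b \<in> M.mball (w n) (inverse (real (Suc n)))" for n
    by (rule assms[of n, unfolded omega_limit_iff, THEN conjunct2, rule_format]) simp_all
  then obtain \<sigma> b where *: "\<And>n. \<sigma> n \<le> min t (- real n)" "\<And>n. b n \<in> AA (\<sigma> n)"
      "\<And>n. S t (\<sigma> n) (b n) \<in> M.mball (w n) (inverse (real (Suc n)))"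
    by metis
  have "filterlim \<sigma> at_bot sequentially"
    using *(1) by (intro filterlim_at_bot_if_le_minus_nat) simp
  moreover have "(\<lambda>n. norm_dist (X t) (N t) (w n) (S t (\<sigma> n) (b n))) \<longlonglongrightarrow> 0"
  proof (rule tendsto_sandwich[OF _ _ tendsto_const LIMSEQ_inverse_real_of_nat])
    show "\<forall>\<^sub>F n in sequentially. norm_dist (X t) (N t) (w n) (S t (\<sigma> n) (b n)) \<le> inverse (real (Suc n))"
      using *(3) by (auto intro!: always_eventually less_imp_le)
  qed simp
  moreover have "\<And>n. \<sigma> n \<le> t" using *(1) by simp
  ultimately show ?thesis using that *(2) by blast
qed

text \<open>
  A sequence in the \<open>\<omega>\<close>-limit is asymptotic to a sequence of evolved states, and the latter has a
  subsequence converging to a point of the \<open>\<omega>\<close>-limit.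
\<close>

lemma compactin_omega_limit: "compactin (norm_topology (X t) (N t)) (omega_limit X N S AA t)"
proof -
  interpret M: Metric_space "X t" "norm_dist (X t) (N t)" by (rule metric)
  have "\<exists>l r. l \<in> omega_limit X N S AA t \<and> strict_mono r \<and> limitin M.mtopology (w \<circ> r) l sequentially"
    if w: "range w \<subseteq> omega_limit X N S AA t" for w :: "nat \<Rightarrow> 'a"
  proof -
    obtain \<sigma> b where \<sigma>: "filterlim \<sigma> at_bot sequentially" "\<And>n. \<sigma> n \<le> t" "\<And>n. b n \<in> AA (\<sigma> n)"
      and d: "(\<lambda>n. norm_dist (X t) (N t) (w n) (S t (\<sigma> n) (b n))) \<longlonglongrightarrow> 0"
      using approximating_sequence[of w t] w by blast
    let ?y = "\<lambda>n. S t (\<sigma> n) (b n)"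
    obtain z r where z: "z \<in> omega_limit X N S AA t" and r: "strict_mono r"
      and lim: "limitin M.mtopology (?y \<circ> r) z sequentially"
      using asymptotically_compact[OF absorber_bounded \<sigma>] unfolding norm_topology_def .
    have "limitin M.mtopology (w \<circ> r) z sequentially"
      unfolding M.limitin_metric_dist_null
    proof (intro conjI)
      show zX: "z \<in> X t" using z by (rule omega_limit_in)
      have wX: "w n \<in> X t" and yX: "?y n \<in> X t" for n
        using w omega_limit_in evolve_in[OF \<sigma>(2) bounded_in[OF absorber_bounded \<sigma>(3)]] by auto
      show "\<forall>\<^sub>F n in sequentially. (w \<circ> r) n \<in> X t" using wX by simp
      have sum: "(\<lambda>n. norm_dist (X t) (N t) (w (r n)) (?y (r n)) + norm_dist (X t) (N t) (?y (r n)) z) \<longlonglongrightarrow> 0"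
        using LIMSEQ_subseq_LIMSEQ[OF d r] lim
        by (intro tendsto_add_zero) (auto simp: M.limitin_metric_dist_null o_def)
      have "norm_dist (X t) (N t) (w (r n)) z \<le>
          norm_dist (X t) (N t) (w (r n)) (?y (r n)) + norm_dist (X t) (N t) (?y (r n)) z" for n
        by (rule M.triangle[OF wX yX zX])
      then show "(\<lambda>n. norm_dist (X t) (N t) ((w \<circ> r) n) z) \<longlonglongrightarrow> 0"
        by (intro tendsto_sandwich[OF _ _ tendsto_const sum]) simp_all
    qed
    with z r show ?thesis by blast
  qed
  then show ?thesis
    unfolding norm_topology_def M.compactin_sequentially using omega_limit_in by blast
qed

lemma sequence_to_omega_limit:
  assumes z: "z \<in> omega_limit X N S AA t"
  obtains \<sigma> b where "filterlim \<sigma> at_bot sequentially" "\<And>n. \<sigma> n \<le> t" "\<And>n. b n \<in> AA (\<sigma> n)"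
    "limitin (norm_topology (X t) (N t)) (\<lambda>n. S t (\<sigma> n) (b n)) z sequentially"
proof -
  interpret M: Metric_space "X t" "norm_dist (X t) (N t)" by (rule metric)
  obtain \<sigma> b where \<sigma>: "filterlim \<sigma> at_bot sequentially" "\<And>n. \<sigma> n \<le> t" "\<And>n. b n \<in> AA (\<sigma> n)"
    and d: "(\<lambda>n. norm_dist (X t) (N t) z (S t (\<sigma> n) (b n))) \<longlonglongrightarrow> 0"
    using approximating_sequence[of "\<lambda>_. z" t] z by blast
  have "limitin (norm_topology (X t) (N t)) (\<lambda>n. S t (\<sigma> n) (b n)) z sequentially"
    unfolding norm_topology_def M.limitin_metric_dist_null
    using d evolve_in[OF \<sigma>(2) bounded_in[OF absorber_bounded \<sigma>(3)]] omega_limit_in[OF z]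
    by (auto simp: M.commute)
  with \<sigma> that show ?thesis by blast
qed

text \<open>
  For the forward inclusion, \<open>S t s\<close> carries a sequence of states converging at time \<open>s\<close> to one
  converging at time \<open>t\<close>, by continuity.  For the converse, states converging at time \<open>t\<close> need not
  converge at time \<open>s\<close>, but asymptotic compactness provides a subsequence that does, and \<open>S t s\<close>
  maps its limit to the given point.
\<close>

lemma omega_limit_invariant:
  assumes "s \<le> t"
  shows "S t s ` omega_limit X N S AA s = omega_limit X N S AA t"
proof (intro subset_antisym subsetI)
  fix z assume "z \<in> S t s ` omega_limit X N S AA s"
  then obtain w where w: "w \<in> omega_limit X N S AA s" and z: "z = S t s w" by blast
  obtain \<sigma> b where \<sigma>: "filterlim \<sigma> at_bot sequentially" "\<And>n. \<sigma> n \<le> s" "\<And>n. b n \<in> AA (\<sigma> n)"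
    and lim: "limitin (norm_topology (X s) (N s)) (\<lambda>n. S s (\<sigma> n) (b n)) w sequentially"
    using sequence_to_omega_limit[OF w] by blast
  have \<sigma>t: "\<sigma> n \<le> t" for n using \<sigma>(2) assms by (rule order_trans)
  have "(S t s \<circ> (\<lambda>n. S s (\<sigma> n) (b n))) = (\<lambda>n. S t (\<sigma> n) (b n))"
    using evolve_evolve[OF \<sigma>(2) assms bounded_in[OF absorber_bounded \<sigma>(3)]] by auto
  with continuous_map_limit[OF continuous[OF assms] lim]
  have lim': "limitin (norm_topology (X t) (N t)) (\<lambda>n. S t (\<sigma> n) (b n)) z sequentially"
    by (simp add: z)
  obtain z' r where z': "z' \<in> omega_limit X N S AA t" "strict_mono r"
    "limitin (norm_topology (X t) (N t)) ((\<lambda>n. S t (\<sigma> n) (b n)) \<circ> r) z' sequentially"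
    using asymptotically_compact[OF absorber_bounded \<sigma>(1) \<sigma>t \<sigma>(3)] .
  have "z' = z"
    using limitin_Hausdorff_unique[OF z'(3) limitin_subsequence[OF z'(2) lim']]
      Hausdorff_norm_topology by simp
  with z' show "z \<in> omega_limit X N S AA t" by simp
next
  fix z assume z: "z \<in> omega_limit X N S AA t"
  obtain \<sigma> b where \<sigma>: "filterlim \<sigma> at_bot sequentially" "\<And>n. \<sigma> n \<le> t" "\<And>n. b n \<in> AA (\<sigma> n)"
    and lim: "limitin (norm_topology (X t) (N t)) (\<lambda>n. S t (\<sigma> n) (b n)) z sequentially"
    using sequence_to_omega_limit[OF z] by blast
  \<comment> \<open>The states at time \<open>s\<close> make sense only once \<open>\<sigma> n \<le> s\<close>.\<close>
  obtain k where k: "\<And>n. k \<le> n \<Longrightarrow> \<sigma> n \<le> s"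
    using \<sigma>(1) unfolding filterlim_at_bot eventually_sequentially by blast
  let ?\<sigma> = "\<lambda>n. \<sigma> (n + k)" and ?b = "\<lambda>n. b (n + k)"
  have \<sigma>': "filterlim ?\<sigma> at_bot sequentially" "\<And>n. ?\<sigma> n \<le> s" "\<And>n. ?b n \<in> AA (?\<sigma> n)"
    using \<sigma> k by (auto intro: filterlim_compose[OF \<sigma>(1) filterlim_add_const_nat_at_top])
  obtain w r where w: "w \<in> omega_limit X N S AA s" and r: "strict_mono r"
    and limw: "limitin (norm_topology (X s) (N s)) ((\<lambda>n. S s (?\<sigma> n) (?b n)) \<circ> r) w sequentially"
    using asymptotically_compact[OF absorber_bounded \<sigma>'] .
  have "S t s \<circ> ((\<lambda>n. S s (?\<sigma> n) (?b n)) \<circ> r) = (\<lambda>n. S t (\<sigma> n) (b n)) \<circ> (\<lambda>n. r n + k)"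
    using evolve_evolve[OF \<sigma>'(2) assms bounded_in[OF absorber_bounded \<sigma>'(3)]] by auto
  moreover have "strict_mono (\<lambda>n. r n + k)" using r by (simp add: strict_mono_def)
  ultimately have "S t s w = z"
    using limitin_Hausdorff_unique[OF continuous_map_limit[OF continuous[OF assms] limw]]
      limitin_subsequence[OF _ lim] Hausdorff_norm_topology by (metis sequentially_bot)
  with w show "z \<in> S t s ` omega_limit X N S AA s" by blast
qed

text \<open>
  A failure of attraction yields evolved states of \<open>B\<close> at times going to \<open>-\<infinity>\<close> that stay at distance
  more than some \<open>e > 0\<close> from the \<open>\<omega>\<close>-limit, against asymptotic compactness.
\<close>

lemma omega_limit_attracts:
  assumes B: "pullback_bounded X N B"
  shows "((\<lambda>s. semidist (N t) (S t s ` B s) (omega_limit X N S AA t)) \<longlongrightarrow> 0) at_bot"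
proof (rule order_tendstoI)
  interpret M: Metric_space "X t" "norm_dist (X t) (N t)" by (rule metric)
  let ?\<omega> = "omega_limit X N S AA t"
  fix a :: ennreal assume "0 < a"
  then obtain q where "0 < q" "q < a" using dense by blast
  then obtain e where e: "0 < e" "ennreal e < a" by (cases q) auto
  have "\<forall>\<^sub>F s in at_bot. semidist (N t) (S t s ` B s) ?\<omega> \<le> ennreal e"
  proof (rule ccontr)
    assume "\<not> ?thesis"
    then have "\<exists>s\<le>min t (- real n). \<not> semidist (N t) (S t s ` B s) ?\<omega> \<le> ennreal e" for n
      unfolding eventually_at_bot_linorder by blast
    then have "\<exists>s\<le>min t (- real n). \<exists>b\<in>B s. \<not> (INF y\<in>?\<omega>. ennreal (N t (S t s b - y))) \<le> ennreal e" for n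
      unfolding semidist_def SUP_le_iff by blast
    then obtain \<sigma> b where \<sigma>: "\<And>n. \<sigma> n \<le> min t (- real n)" and b: "\<And>n. b n \<in> B (\<sigma> n)"
      and far: "\<And>n. \<not> (INF y\<in>?\<omega>. ennreal (N t (S t (\<sigma> n) (b n) - y))) \<le> ennreal e"
      by metis
    have \<sigma>': "filterlim \<sigma> at_bot sequentially" "\<And>n. \<sigma> n \<le> t"
      using \<sigma> by (auto intro: filterlim_at_bot_if_le_minus_nat)
    obtain z r where z: "z \<in> ?\<omega>"
      and lim: "limitin M.mtopology ((\<lambda>n. S t (\<sigma> n) (b n)) \<circ> r) z sequentially"
      using asymptotically_compact[OF B \<sigma>' b] unfolding norm_topology_def .
    then obtain n where "norm_dist (X t) (N t) (S t (\<sigma> (r n)) (b (r n))) z < e"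
      using \<open>0 < e\<close> unfolding M.limitin_metric eventually_sequentially by fastforce
    then have "N t (S t (\<sigma> (r n)) (b (r n)) - z) < e"
      using evolve_in[OF \<sigma>'(2) bounded_in[OF B b]] omega_limit_in[OF z] by (simp add: norm_dist_def)
    then have "(INF y\<in>?\<omega>. ennreal (N t (S t (\<sigma> (r n)) (b (r n)) - y))) \<le> ennreal e"
      using z by (intro INF_lower2[OF z] ennreal_leI) simp
    with far show False by blast
  qed
  then show "\<forall>\<^sub>F s in at_bot. semidist (N t) (S t s ` B s) ?\<omega> < a"
    using e(2) by (auto elim!: eventually_mono)
qed simp

lemma attractor_omega_limit: "time_dependent_global_attractor X N S (omega_limit X N S AA)"
  by (simp add: time_dependent_global_attractor_def compactin_omega_limit omega_limit_invariant
      omega_limit_attracts)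

section \<open>The limit set lies in the absorber\<close>

text \<open>
  The absorber absorbs itself, so every point of the \<open>\<omega>\<close>-limit at time \<open>s\<close> is within distance 1 of
  \<open>AA s\<close>, and a bound for \<open>AA\<close> enlarged by 1 bounds the \<open>\<omega>\<close>-limit.
\<close>

lemma pullback_bounded_omega_limit: "pullback_bounded X N (omega_limit X N S AA)"
  unfolding pullback_bounded_iff
proof (intro conjI allI)
  show "omega_limit X N S AA t \<subseteq> X t" for t using omega_limit_in by blast
  fix t
  obtain C where C: "\<And>s z. s \<le> t \<Longrightarrow> z \<in> AA s \<Longrightarrow> N s z \<le> C"
    using absorber_bounded unfolding pullback_bounded_iff by blast
  have "N s z \<le> 1 + C" if "s \<le> t" and z: "z \<in> omega_limit X N S AA s" for s z
  proof -
    interpret M: Metric_space "X s" "norm_dist (X s) (N s)" by (rule metric)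
    obtain \<tau> where \<tau>: "\<tau> \<le> s" "\<And>r. r \<le> \<tau> \<Longrightarrow> S s r ` AA r \<subseteq> AA s"
      using absorber absorber_bounded unfolding pullback_absorber_def by meson
    obtain r b where "r \<le> \<tau>" "b \<in> AA r" "S s r b \<in> M.mball z 1"
      using z \<tau>(1) unfolding omega_limit_iff by (meson zero_less_one)
    then obtain y where y: "y \<in> AA s" "y \<in> M.mball z 1"
      using \<tau>(2) by blast
    then have zy: "z \<in> X s" "y \<in> X s" "N s (z - y) < 1"
      by (auto simp: norm_dist_def)
    have "N s ((z - y) + y) \<le> N s (z - y) + N s y"
      using norm[of s] zy subspace_diff[of "X s" z y] unfolding norm_on_def by blast
    with zy C[OF \<open>s \<le> t\<close> y(1)] show ?thesis by simp
  qed
  then show "\<exists>C. \<forall>s\<le>t. \<forall>z\<in>omega_limit X N S AA s. N s z \<le> C" by blast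
qed

text \<open>Absorption gives the inclusion for images under \<open>S t s\<close>, and these are the \<open>\<omega>\<close>-limit itself.\<close>

lemma omega_limit_subset_absorber: "omega_limit X N S AA t \<subseteq> AA t"
proof -
  obtain s where "s \<le> t" "S t s ` omega_limit X N S AA s \<subseteq> AA t"
    using absorber pullback_bounded_omega_limit unfolding pullback_absorber_def by blast
  then show ?thesis by (simp add: omega_limit_invariant)
qed

end

theorem corollary2p1:
  fixes X :: "real \<Rightarrow> 'a::real_vector set"
    and N :: "real \<Rightarrow> 'a \<Rightarrow> real"
    and S :: "real \<Rightarrow> real \<Rightarrow> 'a \<Rightarrow> 'a"
    and AA :: "real \<Rightarrow> 'a set"
  assumes "\<And>t. banach_on (X t) (N t)"
    and "process X N S"
    and "pullback_absorber X N S AA"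
    and "\<And>t. ((\<lambda>s. kuratowski (X t) (N t) (S t s ` AA s)) \<longlongrightarrow> 0) at_bot"
  shows "time_dependent_global_attractor X N S (omega_limit X N S AA)
    \<and> (\<forall>t. omega_limit X N S AA t \<subseteq> AA t)
    \<and> pullback_bounded X N (omega_limit X N S AA)
    \<and> (\<forall>A. time_dependent_global_attractor X N S A \<and> pullback_bounded X N A
          \<longrightarrow> A = omega_limit X N S AA)"
proof -
  interpret kuratowski_absorbed_process X N S AA
    using assms by unfold_locales
  have "A = omega_limit X N S AA"
    if "time_dependent_global_attractor X N S A" "pullback_bounded X N A" for A
  proof
    fix t
    show "A t = omega_limit X N S AA t"
      using that attractor_omega_limit pullback_bounded_omega_limit
      by (intro subset_antisym attractor_subset_attractor[where X = X and N = N and S = S] norm)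
  qed
  then show ?thesis
    using attractor_omega_limit omega_limit_subset_absorber pullback_bounded_omega_limit by blast
qed

end
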